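(* Let $d\ge1$, $H>0$, let $\{X(t):t\ge0\}$ be a non-deterministic $H$-selfsimilar additive process on $\mathbb{R}^d$, and let $\rho_1$ be the distribution of $X(1)-X(e^{-1})$. Let $g\in\mathcal{G}_1$ be such that the function $x\mapsto g^{-1}(x)+\log x$ belongs to $OR$. Then $$\limsup_{t\to\infty}\frac{|X(t)|}{t^Hg(\log t)}=C\quad\text{a.s.}$$ holds with $C=0$ if $\int_{\mathbb{R}^d}g^{-1}(|x|)\rho_1(dx)<\infty$, and with $C=\infty$ if $\int_{\mathbb{R}^d}g^{-1}(|x|)\rho_1(dx)=\infty$.
   Context: $|x|$ is the Euclidean norm; "increasing" is in the wide sense. An $\mathbb{R}^d$-valued process $\{X(t):t\ge0\}$ is an $H$-selfsimilar additive process ($H>0$) if: (1) $\{X(ct)\}\stackrel{d}{=}\{c^HX(t)\}$ (equality of finite-dimensional distributions) for every $c>0$; (2) it has independent increments (stationarity not assumed); (3) almost surely its paths are right-continuous with left limits. It is non-deterministic if it is not of the form $X(t)=t^Hc$ with $c\in\mathbb{R}^d$. $\mathcal{G}_1$ is the set of positive increasing functions $g$ on $[0,\infty)$ with $\lim_{x\to\infty}g(x)=\infty$. For $g\in\mathcal{G}_1$, $g^{-1}(x):=\sup\{y:g(y)<x\}$ for $x\ge0$, with $\sup\emptyset=0$. $f\asymp g$ means $0<\liminf_{x\to\infty}f(x)/g(x)\le\limsup_{x\to\infty}f(x)/g(x)<\infty$. A measurable function $h$ (positive for large $x$) belongs to $OR$ if $h(cx)\asymp h(x)$ for every $c>0$.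 *)

theory Defs
  imports "HOL-Probability.Probability"
begin

text \<open>Processes are indexed by all of \<^typ>\<open>real\<close>; every definition only looks at times \<open>t \<ge> 0\<close>.\<close>

definition same_fdd ::
  "'w measure \<Rightarrow> (real \<Rightarrow> 'w \<Rightarrow> 'a::euclidean_space) \<Rightarrow> (real \<Rightarrow> 'w \<Rightarrow> 'a) \<Rightarrow> bool" where
  "same_fdd M X Y \<longleftrightarrow>
    (\<forall>J. finite J \<and> J \<subseteq> {0..} \<longrightarrow>
      distr M (Pi\<^sub>M J (\<lambda>_. borel)) (\<lambda>\<omega>. \<lambda>t\<in>J. X t \<omega>) =
      distr M (Pi\<^sub>M J (\<lambda>_. borel)) (\<lambda>\<omega>. \<lambda>t\<in>J. Y t \<omega>))"

definition selfsimilar ::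
  "'w measure \<Rightarrow> real \<Rightarrow> (real \<Rightarrow> 'w \<Rightarrow> 'a::euclidean_space) \<Rightarrow> bool" where
  "selfsimilar M H X \<longleftrightarrow>
    (\<forall>c>0. same_fdd M (\<lambda>t. X (c * t)) (\<lambda>t \<omega>. (c powr H) *\<^sub>R X t \<omega>))"

text \<open>The value at the first time point need not be listed among the independent variables:
  for a selfsimilar process with \<open>H > 0\<close> one has \<open>X 0 = 0\<close> almost surely, and \<open>s 0 = 0\<close>
  is allowed below.\<close>

definition indep_increments ::
  "'w measure \<Rightarrow> (real \<Rightarrow> 'w \<Rightarrow> 'a::euclidean_space) \<Rightarrow> bool" where
  "indep_increments M X \<longleftrightarrow>
    (\<forall>(n::nat) (s::nat \<Rightarrow> real). 0 \<le> s 0 \<and> (\<forall>i<n. s i < s (Suc i)) \<longrightarrow>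
      prob_space.indep_vars M (\<lambda>_. borel) (\<lambda>i \<omega>. X (s (Suc i)) \<omega> - X (s i) \<omega>) {..<n})"

definition cadlag :: "(real \<Rightarrow> 'a::euclidean_space) \<Rightarrow> bool" where
  "cadlag x \<longleftrightarrow>
    (\<forall>t\<ge>0. continuous (at_right t) x) \<and> (\<forall>t>0. \<exists>l. (x \<longlongrightarrow> l) (at_left t))"

definition selfsimilar_additive ::
  "'w measure \<Rightarrow> real \<Rightarrow> (real \<Rightarrow> 'w \<Rightarrow> 'a::euclidean_space) \<Rightarrow> bool" where
  "selfsimilar_additive M H X \<longleftrightarrow>
    (\<forall>t\<ge>0. X t \<in> borel_measurable M) \<and>
    selfsimilar M H X \<and>
    indep_increments M X \<and>
    (AE \<omega> in M. cadlag (\<lambda>t. X t \<omega>))"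

definition nondeterministic ::
  "'w measure \<Rightarrow> real \<Rightarrow> (real \<Rightarrow> 'w \<Rightarrow> 'a::euclidean_space) \<Rightarrow> bool" where
  "nondeterministic M H X \<longleftrightarrow>
    \<not> (\<exists>c. AE \<omega> in M. \<forall>t\<ge>0. X t \<omega> = (t powr H) *\<^sub>R c)"

text \<open>Functions on \<open>[0,\<infinity>)\<close> are total functions whose values at negative arguments are ignored.\<close>

definition G1 :: "(real \<Rightarrow> real) set" where
  "G1 = {g. (\<forall>x\<ge>0. 0 < g x) \<and> mono_on {0..} g \<and> filterlim g at_top at_top}"

text \<open>The case distinction implements the convention \<open>sup \<emptyset> = 0\<close>, as \<open>Sup {}\<close> is
  unspecified on \<^typ>\<open>real\<close>.\<close>

definition gen_inverse :: "(real \<Rightarrow> real) \<Rightarrow> real \<Rightarrow> real" where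
  "gen_inverse g x =
    (if {y. 0 \<le> y \<and> g y < x} = {} then 0 else Sup {y. 0 \<le> y \<and> g y < x})"

definition asymp_comparable :: "(real \<Rightarrow> real) \<Rightarrow> (real \<Rightarrow> real) \<Rightarrow> bool" where
  "asymp_comparable f g \<longleftrightarrow>
    0 < Liminf at_top (\<lambda>x. ereal (f x / g x)) \<and>
    Liminf at_top (\<lambda>x. ereal (f x / g x)) \<le> Limsup at_top (\<lambda>x. ereal (f x / g x)) \<and>
    Limsup at_top (\<lambda>x. ereal (f x / g x)) < \<infinity>"

definition OR_class :: "(real \<Rightarrow> real) set" where
  "OR_class = {h. h \<in> borel_measurable (restrict_space borel {0<..}) \<and>
    (\<forall>\<^sub>F x in at_top. 0 < h x) \<and>
    (\<forall>c>0. asymp_comparable (\<lambda>x. h (c * x)) h)}"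

end

theory Submission
  imports Defs
begin

text \<open>
  By selfsimilarity the normalised increments \<open>e\<^sup>-\<^sup>H\<^sup>n (X(e\<^sup>n) - X(e\<^sup>n\<^sup>-\<^sup>1))\<close> are independent with law \<open>\<rho>\<^sub>1\<close>.
  Right-continuity at \<open>0\<close> and the second Borel--Cantelli lemma along \<open>e\<^sup>-\<^sup>n\<close> show that \<open>\<rho>\<^sub>1\<close> always has a
  finite logarithmic moment. The \<open>OR\<close> condition therefore makes finiteness of the integral of
  \<open>g\<^sup>-\<^sup>1(c|x|)\<close> independent of \<open>c > 0\<close>, and it is equivalent to summability over \<open>n\<close> of
  \<open>\<rho>\<^sub>1{x. c|x| > g(n)}\<close>. If this series diverges, infinitely many increments exceed any multiple of
  \<open>e\<^sup>H\<^sup>n g(n)\<close>, hence so does \<open>|X(e\<^sup>n)|\<close>. If it converges for every \<open>c\<close>, Ottaviani's inequality controls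
  the oscillation of the path on all blocks \<open>[e\<^sup>n, e\<^sup>n\<^sup>+\<^sup>1]\<close>, and the block bounds add up geometrically.
\<close>

subsection \<open>Independence, Borel--Cantelli and a maximal inequality\<close>

text \<open>Independence only concerns finite index sets, and each of these lies in an initial
  segment.\<close>

lemma (in prob_space) indep_vars_UNIV_I:
  fixes Y :: "nat \<Rightarrow> 'a \<Rightarrow> 'b"
  assumes "\<And>n. indep_vars N Y {..<n}"
  shows "indep_vars N Y UNIV"
proof -
  have "random_variable (N i) (Y i)" for i
    using assms[of "Suc i"] by (auto simp: indep_vars_def2)
  moreover have "indep_sets (\<lambda>i. {Y i -` A \<inter> space M | A. A \<in> sets (N i)}) J"
    if "finite J" for J :: "nat set"
  proof -
    obtain n where "J \<subseteq> {..<n}"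
      using \<open>finite J\<close> by (metis finite_nat_iff_bounded)
    then show ?thesis
      using assms[of n] by (auto simp: indep_vars_def2 intro: indep_sets_mono_index)
  qed
  ultimately show ?thesis
    unfolding indep_vars_def2 by (subst indep_sets_finite_index_sets) auto
qed

text \<open>Serves to list finitely many increments in reversed order of time.\<close>

lemma (in prob_space) indep_vars_reindex:
  assumes inj: "inj_on f I" and indep: "indep_vars N Y (f ` I)"
  shows "indep_vars (\<lambda>i. N (f i)) (\<lambda>i. Y (f i)) I"
  unfolding indep_vars_def2 indep_sets_def
proof (intro conjI ballI allI impI)
  let ?F = "\<lambda>j. {Y j -` A \<inter> space M | A. A \<in> sets (N j)}"
  have F: "indep_sets ?F (f ` I)"
    using indep by (simp add: indep_vars_def2)
  fix J A assume J: "J \<subseteq> I" "J \<noteq> {}" "finite J" and A: "A \<in> Pi J (\<lambda>i. ?F (f i))"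
  have inv: "the_inv_into I f (f i) = i" if "i \<in> J" for i
    using inj J that by (intro the_inv_into_f_f) auto
  have "prob (\<Inter>j\<in>f ` J. A (the_inv_into I f j)) = (\<Prod>j\<in>f ` J. prob (A (the_inv_into I f j)))"
  proof (rule indep_setsD[OF F])
    show "\<forall>j\<in>f ` J. A (the_inv_into I f j) \<in> ?F j"
      using A inv by (auto simp: Pi_iff)
  qed (use J in auto)
  then show "prob (\<Inter>j\<in>J. A j) = (\<Prod>j\<in>J. prob (A j))"
    using inj J by (simp add: inv prod.reindex inj_on_subset)
qed (use indep in \<open>auto simp: indep_vars_def\<close>)

text \<open>Second Borel-Cantelli lemma. By independence, the probability that no event with index
  in \<open>{m..<k}\<close> occurs is a product of factors \<open>1 - p n \<le> exp (- p n)\<close>,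
  and the divergent series drives it to 0 as k grows.\<close>

lemma (in prob_space) borel_cantelli_AE2:
  fixes Y :: "nat \<Rightarrow> 'a \<Rightarrow> 'b"
  assumes indep: "indep_vars N Y UNIV"
    and B: "\<And>n. B n \<in> sets (N n)"
    and div: "\<not> summable (\<lambda>n. prob {\<omega>\<in>space M. Y n \<omega> \<in> B n})"
  shows "AE \<omega> in M. \<exists>\<^sub>F n in sequentially. Y n \<omega> \<in> B n"
proof -
  have Y [measurable]: "Y n \<in> measurable M (N n)" for n
    using indep by (auto simp: indep_vars_def)
  note B [measurable]
  define p where "p n = prob {\<omega>\<in>space M. Y n \<omega> \<in> B n}" for n
  define Z where "Z m = {\<omega>\<in>space M. \<forall>n\<ge>m. Y n \<omega> \<notin> B n}" for m
  have Z_sets [measurable]: "Z m \<in> events" for m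
    unfolding Z_def by measurable
  have prod_le: "prob (Z m) \<le> exp (- (\<Sum>n=m..<k. p n))" if "m < k" for m k
  proof -
    have "prob (Z m) \<le> prob (\<Inter>n\<in>{m..<k}. Y n -` (space (N n) - B n) \<inter> space M)"
      using \<open>m < k\<close> Y[THEN measurable_space]
      by (intro finite_measure_mono sets.finite_INT) (auto simp: Z_def)
    also have "\<dots> = (\<Prod>n=m..<k. prob (Y n -` (space (N n) - B n) \<inter> space M))"
      using \<open>m < k\<close> by (intro indep_varsD[OF indep]) auto
    also have "\<dots> = (\<Prod>n=m..<k. 1 - p n)"
    proof (rule prod.cong)
      fix n
      have "Y n -` (space (N n) - B n) \<inter> space M = space M - {\<omega>\<in>space M. Y n \<omega> \<in> B n}"
        using Y[of n, THEN measurable_space] by auto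
      then show "prob (Y n -` (space (N n) - B n) \<inter> space M) = 1 - p n"
        by (simp add: p_def prob_compl)
    qed simp
    also have "\<dots> \<le> (\<Prod>n=m..<k. exp (- p n))"
      using exp_ge_add_one_self[of "- p _"] by (intro prod_mono) (auto simp: p_def)
    also have "\<dots> = exp (- (\<Sum>n=m..<k. p n))"
      by (simp add: exp_sum flip: sum_negf)
    finally show ?thesis .
  qed
  have "AE \<omega> in M. \<omega> \<notin> Z m" for m
  proof -
    \<comment> \<open>If \<open>prob (Z m)\<close> exceeded some e > 0, then \<open>prod_le\<close>
      would bound all partial sums of p by a constant involving \<open>- ln e\<close>, against
      divergence.\<close>
    have "prob (Z m) \<le> e" if "e > 0" for e
    proof (rule ccontr)
      assume "\<not> prob (Z m) \<le> e"
      then have less: "e < prob (Z m)" by simp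
      have "sum p {..<k} \<le> (\<Sum>n<m. p n) - ln e" for k
      proof (cases "m < k")
        case True
        have "e < exp (- (\<Sum>n=m..<k. p n))"
          using prod_le[OF True] less by linarith
        then have "ln e < - (\<Sum>n=m..<k. p n)"
          using \<open>e > 0\<close> by (metis exp_gt_zero ln_exp ln_less_cancel_iff)
        moreover have "sum p {..<k} = (\<Sum>n<m. p n) + (\<Sum>n=m..<k. p n)"
          using True by (simp add: lessThan_atLeast0 sum.atLeastLessThan_concat)
        ultimately show ?thesis by simp
      next
        case False
        have "e < 1" using less prob_le_1[of "Z m"] by linarith
        then have "ln e < 0" using \<open>e > 0\<close> by simp
        moreover have "sum p {..<k} \<le> (\<Sum>n<m. p n)"
          using False by (intro sum_mono2) (auto simp: p_def)
        ultimately show ?thesis by simp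
      qed
      then have "summable p"
        by (intro summableI_nonneg_bounded[where x = "(\<Sum>n<m. p n) - ln e"]) (auto simp: p_def)
      with div show False by (simp add: p_def[abs_def])
    qed
    then have "prob (Z m) \<le> 0"
      by (meson field_le_epsilon dense_ge)
    then have "prob (Z m) = 0"
      by (simp add: measure_le_0_iff)
    then show ?thesis
      using prob_eq_0[of "Z m"] by simp
  qed
  then have "AE \<omega> in M. \<forall>m. \<omega> \<notin> Z m"
    by (simp add: AE_all_countable)
  then show ?thesis
    by (rule AE_mp, intro AE_I2) (auto simp: Z_def frequently_sequentially)
qed

text \<open>The floor of W counts the n with \<open>real (Suc n) \<le> W\<close>, so its integral is
  exactly the tail series. W and its floor differ by at most 1, which is integrable for a
  probability measure.\<close>

lemma (in prob_space) nn_integral_finite_iff_summable_tail: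
  fixes W :: "'a \<Rightarrow> real"
  assumes [measurable]: "W \<in> borel_measurable M" and nonneg: "\<And>\<omega>. 0 \<le> W \<omega>"
  shows "(\<integral>\<^sup>+\<omega>. ennreal (W \<omega>) \<partial>M) < \<infinity> \<longleftrightarrow>
    summable (\<lambda>n. prob {\<omega>\<in>space M. real (Suc n) \<le> W \<omega>})"
proof -
  define f where "f \<omega> = nat \<lfloor>W \<omega>\<rfloor>" for \<omega>
  have f [measurable]: "f \<in> measurable M (count_space UNIV)"
    unfolding f_def by measurable
  have "n < f \<omega> \<longleftrightarrow> real (Suc n) \<le> W \<omega>" for n \<omega>
  proof -
    have "n < f \<omega> \<longleftrightarrow> int (Suc n) \<le> \<lfloor>W \<omega>\<rfloor>"
      unfolding f_def by linarith
    then show ?thesis by (simp add: le_floor_iff)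
  qed
  then have floor_sum: "(\<integral>\<^sup>+\<omega>. of_nat (f \<omega>) \<partial>M) =
      (\<Sum>n. ennreal (prob {\<omega>\<in>space M. real (Suc n) \<le> W \<omega>}))"
    by (simp add: nn_integral_nat_function emeasure_eq_measure)
  have f_le: "of_nat (f \<omega>) \<le> ennreal (W \<omega>)" and le_f: "ennreal (W \<omega>) \<le> of_nat (f \<omega>) + 1" for \<omega>
  proof -
    have "real (f \<omega>) \<le> W \<omega>" "W \<omega> \<le> real (f \<omega>) + 1"
      using nonneg[of \<omega>] unfolding f_def by linarith+
    then show "of_nat (f \<omega>) \<le> ennreal (W \<omega>)" "ennreal (W \<omega>) \<le> of_nat (f \<omega>) + 1"
      by (simp_all add: ennreal_leI ennreal_of_nat_eq_real_of_nat flip: ennreal_1 ennreal_plus)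
  qed
  have "(\<integral>\<^sup>+\<omega>. ennreal (W \<omega>) \<partial>M) < \<infinity> \<longleftrightarrow> (\<integral>\<^sup>+\<omega>. of_nat (f \<omega>) \<partial>M) < \<infinity>"
  proof
    assume "(\<integral>\<^sup>+\<omega>. ennreal (W \<omega>) \<partial>M) < \<infinity>"
    then show "(\<integral>\<^sup>+\<omega>. of_nat (f \<omega>) \<partial>M) < \<infinity>"
      using nn_integral_mono[of M "\<lambda>\<omega>. of_nat (f \<omega>)" "\<lambda>\<omega>. ennreal (W \<omega>)"] f_le
      by (meson order_le_less_trans)
  next
    assume fin: "(\<integral>\<^sup>+\<omega>. of_nat (f \<omega>) \<partial>M) < \<infinity>"
    have "(\<integral>\<^sup>+\<omega>. ennreal (W \<omega>) \<partial>M) \<le> (\<integral>\<^sup>+\<omega>. of_nat (f \<omega>) + 1 \<partial>M)"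
      by (intro nn_integral_mono le_f)
    also have "\<dots> = (\<integral>\<^sup>+\<omega>. of_nat (f \<omega>) \<partial>M) + 1"
      by (subst nn_integral_add) (auto simp: emeasure_space_1)
    also have "\<dots> < \<infinity>"
      using fin by (simp add: less_top)
    finally show "(\<integral>\<^sup>+\<omega>. ennreal (W \<omega>) \<partial>M) < \<infinity>" .
  qed
  also have "\<dots> \<longleftrightarrow> summable (\<lambda>n. prob {\<omega>\<in>space M. real (Suc n) \<le> W \<omega>})"
    unfolding floor_sum
    by (auto intro: summable_suminf_not_top simp: ennreal_suminf_neq_top less_top)
  finally show ?thesis .
qed

text \<open>Decompose by the first index k at which the partial sum exceeds a + b. The remaining sum
  is independent of this event and has norm at most b with probability at least 1/2; when both
  happen, the full sum has norm greater than a.\<close>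

lemma (in prob_space) ottaviani:
  fixes D :: "nat \<Rightarrow> 'a \<Rightarrow> 'b::euclidean_space"
  assumes indep: "indep_vars (\<lambda>_. borel) D {..<n}"
    and tail: "\<And>k. k \<le> n \<Longrightarrow> prob {\<omega>\<in>space M. b < norm (\<Sum>i=k..<n. D i \<omega>)} \<le> 1 / 2"
  shows "prob {\<omega>\<in>space M. \<exists>k\<le>n. a + b < norm (\<Sum>i<k. D i \<omega>)} \<le>
    2 * prob {\<omega>\<in>space M. a < norm (\<Sum>i<n. D i \<omega>)}"
proof -
  have D [measurable]: "D i \<in> borel_measurable M" if "i < n" for i
    using indep that by (auto simp: indep_vars_def)
  have S: "(\<lambda>\<omega>. \<Sum>i<k. D i \<omega>) \<in> borel_measurable M" if "k \<le> n" for k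
    using that by (intro borel_measurable_sum D) auto
  have R: "(\<lambda>\<omega>. \<Sum>i=k..<n. D i \<omega>) \<in> borel_measurable M" for k
    by (intro borel_measurable_sum D) auto
  define A where "A k = {\<omega>\<in>space M. a + b < norm (\<Sum>i<k. D i \<omega>) \<and>
    (\<forall>j\<in>{..<k}. norm (\<Sum>i<j. D i \<omega>) \<le> a + b)}" for k
  define C where "C k = {\<omega>\<in>space M. norm (\<Sum>i=k..<n. D i \<omega>) \<le> b}" for k
  have A_sets: "A k \<in> events" if "k \<le> n" for k
    unfolding A_def
    by (intro sets.sets_Collect_conj sets.sets_Collect_finite_All borel_measurable_less
        borel_measurable_le borel_measurable_norm S) (use that in auto)
  have C_sets: "C k \<in> events" for k
    unfolding C_def using R[of k] by measurable
  have C_prob: "1 / 2 \<le> prob (C k)" if "k \<le> n" for k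
  proof -
    have "C k = space M - {\<omega>\<in>space M. b < norm (\<Sum>i=k..<n. D i \<omega>)}"
      by (auto simp: C_def)
    then show ?thesis
      using tail[OF that] R[of k] by (simp add: prob_compl)
  qed
  have AC: "prob (A k \<inter> C k) = prob (A k) * prob (C k)" if "k \<le> n" for k
  proof -
    \<comment> \<open>\<open>P\<close> and \<open>Q\<close> describe \<open>A k\<close> and
      \<open>C k\<close> through the coordinates below k and from k on. These blocks are disjoint,
      so the restricted families are independent.\<close>
    define P where "P = {f\<in>space (PiM {..<k} (\<lambda>_. borel)). a + b < norm (\<Sum>i<k. f i :: 'b) \<and>
      (\<forall>j\<in>{..<k}. norm (\<Sum>i<j. f i) \<le> a + b)}"
    define Q where "Q = {f\<in>space (PiM {k..<n} (\<lambda>_. borel)). norm (\<Sum>i=k..<n. f i :: 'b) \<le> b}"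
    have P: "P \<in> sets (PiM {..<k} (\<lambda>_. borel))"
      unfolding P_def
      by (intro sets.sets_Collect_conj sets.sets_Collect_finite_All borel_measurable_less
          borel_measurable_le borel_measurable_norm borel_measurable_sum
          measurable_component_singleton borel_measurable_const) auto
    have Q: "Q \<in> sets (PiM {k..<n} (\<lambda>_. borel))"
      unfolding Q_def
      by (intro borel_measurable_le borel_measurable_norm borel_measurable_sum
          measurable_component_singleton borel_measurable_const) auto
    have "indep_var (PiM {..<k} (\<lambda>_. borel)) (\<lambda>\<omega>. restrict (\<lambda>i. D i \<omega>) {..<k})
        (PiM {k..<n} (\<lambda>_. borel)) (\<lambda>\<omega>. restrict (\<lambda>i. D i \<omega>) {k..<n})"
      using that by (intro indep_var_restrict[OF indep]) auto
    from indep_varD[OF this P Q] show ?thesis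
    proof (rule trans[OF trans[OF arg_cong[where f = prob]], rotated])
      have "(\<lambda>\<omega>. restrict (\<lambda>i. D i \<omega>) {..<k}) -` P \<inter> space M = A k"
        by (auto simp: P_def A_def space_PiM)
      moreover have "(\<lambda>\<omega>. restrict (\<lambda>i. D i \<omega>) {k..<n}) -` Q \<inter> space M = C k"
        by (auto simp: Q_def C_def space_PiM)
      ultimately show "prob ((\<lambda>\<omega>. restrict (\<lambda>i. D i \<omega>) {..<k}) -` P \<inter> space M) *
          prob ((\<lambda>\<omega>. restrict (\<lambda>i. D i \<omega>) {k..<n}) -` Q \<inter> space M) = prob (A k) * prob (C k)"
        by simp
    qed (auto simp: P_def Q_def A_def C_def space_PiM)
  qed
  have disj: "disjoint_family_on A {..n}"
    unfolding disjoint_family_on_def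
  proof (intro ballI impI)
    fix k l :: nat assume "k \<noteq> l"
    have "A i \<inter> A j = {}" if "i < j" for i j
      unfolding A_def using that by (auto simp: not_le dest!: bspec[of _ _ i])
    with \<open>k \<noteq> l\<close> show "A k \<inter> A l = {}"
      by (cases k l rule: linorder_cases) blast+
  qed
  have "{\<omega>\<in>space M. \<exists>k\<le>n. a + b < norm (\<Sum>i<k. D i \<omega>)} \<subseteq> (\<Union>k\<in>{..n}. A k)"
  proof safe
    fix \<omega> k assume "\<omega> \<in> space M" "k \<le> n" and exceed: "a + b < norm (\<Sum>i<k. D i \<omega>)"
    obtain l where "a + b < norm (\<Sum>i<l. D i \<omega>)" "\<And>j. j < l \<Longrightarrow> norm (\<Sum>i<j. D i \<omega>) \<le> a + b"
      using exceed exists_least_iff[of "\<lambda>k. a + b < norm (\<Sum>i<k. D i \<omega>)"] by (auto simp: not_less)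
    moreover from this exceed have "l \<le> k"
      by (meson not_le not_less)
    ultimately show "\<omega> \<in> (\<Union>k\<in>{..n}. A k)"
      using \<open>\<omega> \<in> space M\<close> \<open>k \<le> n\<close> by (auto simp: A_def intro!: bexI[of _ l])
  qed
  then have "prob {\<omega>\<in>space M. \<exists>k\<le>n. a + b < norm (\<Sum>i<k. D i \<omega>)} \<le> prob (\<Union>k\<in>{..n}. A k)"
    using A_sets by (intro finite_measure_mono) auto
  also have "\<dots> = (\<Sum>k\<le>n. prob (A k))"
    using A_sets by (intro finite_measure_finite_Union disj) auto
  \<comment> \<open>Independence and \<open>C_prob\<close> show that intersecting with
    \<open>C k\<close> loses at most half of the probability of \<open>A k\<close>.\<close>
  also have "\<dots> \<le> (\<Sum>k\<le>n. 2 * prob (A k \<inter> C k))"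
  proof (rule sum_mono)
    fix k assume "k \<in> {..n}"
    then show "prob (A k) \<le> 2 * prob (A k \<inter> C k)"
      using mult_left_mono[OF C_prob[of k], of "2 * prob (A k)"] AC[of k] by simp
  qed
  also have "\<dots> = 2 * prob (\<Union>k\<in>{..n}. A k \<inter> C k)"
    using disj A_sets C_sets
    by (subst finite_measure_finite_Union)
      (auto simp: sum_distrib_left disjoint_family_on_def)
  also have "\<dots> \<le> 2 * prob {\<omega>\<in>space M. a < norm (\<Sum>i<n. D i \<omega>)}"
  proof -
    have "a < norm (\<Sum>i<n. D i \<omega>)" if "\<omega> \<in> A k" "\<omega> \<in> C k" "k \<le> n" for \<omega> k
    proof -
      have "(\<Sum>i<n. D i \<omega>) = (\<Sum>i<k. D i \<omega>) + (\<Sum>i=k..<n. D i \<omega>)"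
        using \<open>k \<le> n\<close> by (simp add: lessThan_atLeast0 sum.atLeastLessThan_concat)
      then have "norm (\<Sum>i<k. D i \<omega>) \<le> norm (\<Sum>i<n. D i \<omega>) + norm (\<Sum>i=k..<n. D i \<omega>)"
        using norm_triangle_ineq4[of "\<Sum>i<n. D i \<omega>" "\<Sum>i=k..<n. D i \<omega>"] by simp
      then show ?thesis using that by (auto simp: A_def C_def)
    qed
    moreover have "A k \<subseteq> space M" for k by (auto simp: A_def)
    ultimately show ?thesis
      using S[of n] by (intro mult_left_mono finite_measure_mono) auto
  qed
  finally show ?thesis .
qed

subsection \<open>The generalised inverse and the class OR\<close>

text \<open>Divergence of g to infinity makes the supremum in \<open>gen_inverse\<close> a genuine
  one.\<close>

lemma bdd_above_G1_sublevel:
  assumes "g \<in> G1"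
  shows "bdd_above {y. 0 \<le> y \<and> g y < x}"
proof -
  obtain z where "\<And>y. y \<ge> z \<Longrightarrow> x \<le> g y"
    using assms unfolding G1_def filterlim_at_top eventually_at_top_linorder by blast
  then show ?thesis
    by (intro bdd_aboveI[of _ z]) (metis (mono_tags, lifting) linorder_le_cases mem_Collect_eq not_less)
qed

lemma le_gen_inverse:
  assumes "g \<in> G1" "0 \<le> y" "g y < x"
  shows "y \<le> gen_inverse g x"
  using assms bdd_above_G1_sublevel[OF \<open>g \<in> G1\<close>, of x]
  by (auto simp: gen_inverse_def intro!: cSup_upper)

lemma gen_inverse_nonneg:
  assumes "g \<in> G1"
  shows "0 \<le> gen_inverse g x"
proof (cases "{y. 0 \<le> y \<and> g y < x} = {}")
  case False
  then obtain y where "0 \<le> y" "g y < x" by auto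
  then show ?thesis using le_gen_inverse[OF assms] by fastforce
qed (simp add: gen_inverse_def)

text \<open>Near-converse of \<open>le_gen_inverse\<close>. The supremum need not be attained, so y
  has to lie strictly below it; some z > y in the sublevel set then dominates y by monotonicity of
  g.\<close>

lemma less_of_less_gen_inverse:
  assumes "g \<in> G1" "0 \<le> y" "y < gen_inverse g x"
  shows "g y < x"
proof -
  have "{y. 0 \<le> y \<and> g y < x} \<noteq> {}"
    using assms by (auto simp: gen_inverse_def split: if_splits)
  then obtain z where "0 \<le> z" "g z < x" "y < z"
    using assms bdd_above_G1_sublevel[OF \<open>g \<in> G1\<close>, of x]
    by (auto simp: gen_inverse_def less_cSup_iff split: if_splits)
  moreover have "g y \<le> g z"
    using assms \<open>y < z\<close> by (auto simp: G1_def mono_on_def)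
  ultimately show ?thesis by simp
qed

lemma mono_gen_inverse:
  assumes "g \<in> G1"
  shows "mono (gen_inverse g)"
proof (rule monoI, rule ccontr)
  fix x x' :: real assume "x \<le> x'" and "\<not> gen_inverse g x \<le> gen_inverse g x'"
  \<comment> \<open>A point between the two values avoids comparing suprema, one of which might be
    the default value 0 of an empty set.\<close>
  then obtain y where y: "gen_inverse g x' < y" "y < gen_inverse g x"
    using dense by (auto simp: not_le)
  then have "0 \<le> y"
    using gen_inverse_nonneg[OF assms, of x'] by simp
  then have "g y < x'"
    using less_of_less_gen_inverse[OF assms _ y(2)] \<open>x \<le> x'\<close> by simp
  then show False
    using le_gen_inverse[OF assms \<open>0 \<le> y\<close>] y by fastforce
qed

lemma measurable_gen_inverse [measurable]:
  assumes "g \<in> G1"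
  shows "gen_inverse g \<in> borel_measurable borel"
  using mono_gen_inverse[OF assms] by (rule borel_measurable_mono)

lemma OR_class_upper:
  assumes "h \<in> OR_class" "c > 0"
  obtains K where "K > 0" "\<forall>\<^sub>F x in at_top. h (c * x) \<le> K * h x"
proof -
  have "Limsup at_top (\<lambda>x. ereal (h (c * x) / h x)) < \<infinity>"
    using assms by (auto simp: OR_class_def asymp_comparable_def)
  then obtain n :: nat where "Limsup at_top (\<lambda>x. ereal (h (c * x) / h x)) < ereal (real n)"
    using less_PInf_Ex_of_nat by auto
  then have "\<forall>\<^sub>F x in at_top. ereal (h (c * x) / h x) < ereal (real n)"
    by (rule Limsup_lessD)
  moreover have "\<forall>\<^sub>F x in at_top. 0 < h x"
    using assms by (simp add: OR_class_def)
  \<comment> \<open>\<open>Suc n\<close> instead of n keeps the constant positive even when n =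
    0.\<close>
  ultimately have "\<forall>\<^sub>F x in at_top. h (c * x) \<le> real (Suc n) * h x"
    by eventually_elim (simp add: field_simps)
  then show ?thesis
    using that[of "real (Suc n)"] by simp
qed

text \<open>For large x the \<open>OR\<close> bound, applied at a * x with ratio b / a, compares the
  inverse at b * x with that at a * x up to a factor K and a logarithmic error. The logarithmic
  moment absorbs this error, and monotonicity handles the remaining x.\<close>

lemma (in prob_space) nn_integral_gen_inverse_scale:
  fixes Z :: "'a \<Rightarrow> real"
  assumes g: "g \<in> G1" and OR: "(\<lambda>x. gen_inverse g x + ln x) \<in> OR_class"
    and [measurable]: "Z \<in> borel_measurable M" and "a > 0" "b > 0"
    and fin: "(\<integral>\<^sup>+\<omega>. ennreal (gen_inverse g (a * Z \<omega>)) \<partial>M) < \<infinity>"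
    and fin_ln: "(\<integral>\<^sup>+\<omega>. ennreal (max 0 (ln (Z \<omega>))) \<partial>M) < \<infinity>"
  shows "(\<integral>\<^sup>+\<omega>. ennreal (gen_inverse g (b * Z \<omega>)) \<partial>M) < \<infinity>"
proof -
  note [measurable] = measurable_gen_inverse[OF g]
  have "b / a > 0" using \<open>a > 0\<close> \<open>b > 0\<close> by simp
  then obtain K where "K > 0" and
    "\<forall>\<^sub>F x in at_top. gen_inverse g (b / a * x) + ln (b / a * x) \<le> K * (gen_inverse g x + ln x)"
    using OR_class_upper[OF OR] by blast
  then obtain x0 where x0: "\<And>x. x \<ge> x0 \<Longrightarrow>
      gen_inverse g (b / a * x) + ln (b / a * x) \<le> K * (gen_inverse g x + ln x)"
    unfolding eventually_at_top_linorder by blast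
  \<comment> \<open>From x1 on, a * x is in the range of the \<open>OR\<close> bound and
    \<open>ln x\<close> is nonnegative. The constant B collects the terms from \<open>ln a\<close>
    and \<open>ln b\<close> and the bound valid below x1.\<close>
  define x1 where "x1 = max (x0 / a) 1"
  define B where "B = K * \<bar>ln a\<bar> + \<bar>ln b\<bar> + gen_inverse g (b * x1)"
  have "0 \<le> B"
    using gen_inverse_nonneg[OF g] \<open>K > 0\<close> by (simp add: B_def)
  have pointwise: "gen_inverse g (b * x) \<le> K * gen_inverse g (a * x) + K * max 0 (ln x) + B" for x
  proof (cases "x1 \<le> x")
    case True
    then have "1 \<le> x" "x0 \<le> a * x"
      using \<open>a > 0\<close> by (auto simp: x1_def field_simps)
    then have "gen_inverse g (b * x) + (ln b + ln x) \<le> K * (gen_inverse g (a * x) + (ln a + ln x))"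
      using x0[of "a * x"] \<open>a > 0\<close> \<open>b > 0\<close> by (simp add: ln_mult)
    moreover have "0 \<le> ln x" using \<open>1 \<le> x\<close> by simp
    moreover have "K * ln a \<le> K * \<bar>ln a\<bar>" using \<open>K > 0\<close> by simp
    moreover have "0 \<le> gen_inverse g (b * x1)" by (rule gen_inverse_nonneg[OF g])
    ultimately show ?thesis
      unfolding B_def distrib_left by linarith
  next
    case False
    then have "gen_inverse g (b * x) \<le> gen_inverse g (b * x1)"
      using \<open>b > 0\<close> by (intro monoD[OF mono_gen_inverse[OF g]] mult_left_mono) auto
    moreover have "0 \<le> K * gen_inverse g (a * x) + K * max 0 (ln x)" "0 \<le> K * \<bar>ln a\<bar>"
      using \<open>K > 0\<close> gen_inverse_nonneg[OF g] by simp_all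
    ultimately show ?thesis by (simp add: B_def)
  qed
  have "(\<integral>\<^sup>+\<omega>. ennreal (gen_inverse g (b * Z \<omega>)) \<partial>M) \<le>
      (\<integral>\<^sup>+\<omega>. ennreal K * ennreal (gen_inverse g (a * Z \<omega>)) + ennreal K * ennreal (max 0 (ln (Z \<omega>))) + ennreal B \<partial>M)"
    using \<open>K > 0\<close> \<open>0 \<le> B\<close> gen_inverse_nonneg[OF g] pointwise
    by (intro nn_integral_mono) (simp add: ennreal_leI del: ennreal_max_0 flip: ennreal_mult ennreal_plus)
  also have "\<dots> = ennreal K * (\<integral>\<^sup>+\<omega>. ennreal (gen_inverse g (a * Z \<omega>)) \<partial>M) +
      ennreal K * (\<integral>\<^sup>+\<omega>. ennreal (max 0 (ln (Z \<omega>))) \<partial>M) + ennreal B"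
    by (simp add: nn_integral_add nn_integral_cmult emeasure_space_1)
  also have "\<dots> < \<infinity>"
    using fin fin_ln by (simp add: ennreal_mult_less_top less_top)
  finally show ?thesis .
qed

text \<open>The factor c is introduced by the scaling lemma. Then the event that the inverse at c *
  Z is at least n + 1 contains \<open>g (n + 1) < c * Z\<close> and is contained in
  \<open>g n < c * Z\<close>, so the two series differ by at most a shift of the index.\<close>

lemma (in prob_space) nn_integral_gen_inverse_iff_summable:
  fixes Z :: "'a \<Rightarrow> real"
  assumes g: "g \<in> G1" and OR: "(\<lambda>x. gen_inverse g x + ln x) \<in> OR_class"
    and [measurable]: "Z \<in> borel_measurable M" and "c > 0"
    and fin_ln: "(\<integral>\<^sup>+\<omega>. ennreal (max 0 (ln (Z \<omega>))) \<partial>M) < \<infinity>"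
  shows "(\<integral>\<^sup>+\<omega>. ennreal (gen_inverse g (Z \<omega>)) \<partial>M) < \<infinity> \<longleftrightarrow>
    summable (\<lambda>n. prob {\<omega>\<in>space M. g (real n) < c * Z \<omega>})"
proof -
  note [measurable] = measurable_gen_inverse[OF g]
  let ?P = "\<lambda>n. prob {\<omega>\<in>space M. real (Suc n) \<le> gen_inverse g (c * Z \<omega>)}"
  let ?Q = "\<lambda>n. prob {\<omega>\<in>space M. g (real n) < c * Z \<omega>}"
  have "(\<integral>\<^sup>+\<omega>. ennreal (gen_inverse g (Z \<omega>)) \<partial>M) < \<infinity> \<longleftrightarrow>
      (\<integral>\<^sup>+\<omega>. ennreal (gen_inverse g (c * Z \<omega>)) \<partial>M) < \<infinity>"
    using nn_integral_gen_inverse_scale[OF g OR _ zero_less_one \<open>c > 0\<close> _ fin_ln]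
      nn_integral_gen_inverse_scale[OF g OR _ \<open>c > 0\<close> zero_less_one _ fin_ln] by auto
  also have "\<dots> \<longleftrightarrow> summable ?P"
    by (intro nn_integral_finite_iff_summable_tail gen_inverse_nonneg[OF g]) measurable
  also have "\<dots> \<longleftrightarrow> summable ?Q"
  proof
    assume P: "summable ?P"
    have "?Q (Suc n) \<le> ?P n" for n
      by (intro finite_measure_mono) (auto intro: le_gen_inverse[OF g])
    then have "summable (\<lambda>n. ?Q (Suc n))"
      by (intro summable_comparison_test'[OF P]) auto
    then show "summable ?Q"
      by (subst (asm) summable_Suc_iff)
  next
    assume Q: "summable ?Q"
    have "?P n \<le> ?Q n" for n
      by (intro finite_measure_mono) (auto intro: less_of_less_gen_inverse[OF g])
    then show "summable ?P"
      by (intro summable_comparison_test'[OF Q]) auto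
  qed
  finally show ?thesis .
qed

subsection \<open>Paths along exponential times\<close>

text \<open>The normalisation w grows by a factor of at least \<open>exp H\<close> per block, so the
  accumulated oscillations form a geometric series dominated by its last term. The value at the
  starting time is negligible since the denominator tends to infinity.\<close>

lemma growth_from_exponential_blocks:
  fixes x :: "real \<Rightarrow> 'a::real_normed_vector"
  assumes "H > 0" and "g \<in> G1"
    and blocks: "\<And>e. e > 0 \<Longrightarrow> \<forall>\<^sub>F n in sequentially. \<forall>t\<in>{exp (real n)..exp (real (Suc n))}.
      norm (x t - x (exp (real n))) \<le> e * (exp (real n) powr H * g (real n))"
  shows "((\<lambda>t. norm (x t) / (t powr H * g (ln t))) \<longlongrightarrow> 0) at_top"
proof -
  have g_pos: "0 < g y" if "0 \<le> y" for y
    using \<open>g \<in> G1\<close> that by (auto simp: G1_def)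
  have g_mono: "g y \<le> g z" if "0 \<le> y" "y \<le> z" for y z
    using \<open>g \<in> G1\<close> that by (auto simp: G1_def mono_on_def)
  have "LIM t at_top. g (ln t) :> at_top"
    using \<open>g \<in> G1\<close> ln_at_top by (auto simp: G1_def intro: filterlim_compose)
  then have W_lim: "LIM t at_top. t powr H * g (ln t) :> at_top"
  proof (rule filterlim_at_top_mono)
    show "\<forall>\<^sub>F t in at_top. g (ln t) \<le> t powr H * g (ln t)"
      using eventually_ge_at_top[of 1]
    proof eventually_elim
      case (elim t)
      then have "1 \<le> t powr H" "0 < g (ln t)"
        using \<open>H > 0\<close> by (auto intro: ge_one_powr_ge_zero g_pos)
      then show ?case by simp
    qed
  qed
  define w where "w n = exp (real n) powr H * g (real n)" for n
  have w_nonneg: "0 \<le> w n" for n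
    unfolding w_def using g_pos[of "real n"] by simp
  have w_Suc: "exp H * w n \<le> w (Suc n)" for n
  proof -
    have "exp H * w n = exp (real (Suc n)) powr H * g (real n)"
      by (simp add: w_def powr_def exp_add[symmetric] algebra_simps)
    also have "\<dots> \<le> w (Suc n)"
      unfolding w_def by (intro mult_left_mono g_mono) auto
    finally show ?thesis .
  qed
  \<comment> \<open>Chosen as the solution of q + 1 = q * \<open>exp H\<close>: adding one more
    block to a bound with factor q then reproduces that bound at the next index.\<close>
  define q where "q = 1 / (exp H - 1)"
  have q: "0 < q" "q + 1 = q * exp H"
    using \<open>H > 0\<close> by (auto simp: q_def field_simps)
  show ?thesis
  proof (rule tendstoI)
    fix \<delta> :: real assume "\<delta> > 0"
    \<comment> \<open>Half of \<delta> pays for the blocks, including the incomplete last one; the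
      other half pays for the constant C.\<close>
    define e where "e = \<delta> / (2 * (q + 1))"
    have e: "e > 0" "e * (q + 1) = \<delta> / 2"
      using \<open>\<delta> > 0\<close> q by (auto simp: e_def)
    obtain N where N: "\<And>n t. n \<ge> N \<Longrightarrow> t \<in> {exp (real n)..exp (real (Suc n))} \<Longrightarrow>
        norm (x t - x (exp (real n))) \<le> e * w n"
      using blocks[OF \<open>e > 0\<close>] unfolding eventually_sequentially w_def by blast
    define C where "C = norm (x (exp (real N)))"
    have at_exp: "norm (x (exp (real n))) \<le> C + e * q * w n" if "N \<le> n" for n
      using that
    proof (induction n rule: dec_induct)
      case base
      then show ?case
        using w_nonneg[of N] e q by (simp add: C_def)
    next
      case (step n)
      have "norm (x (exp (real (Suc n)))) \<le>
          norm (x (exp (real n))) + norm (x (exp (real (Suc n))) - x (exp (real n)))"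
        using norm_triangle_ineq[of "x (exp (real n))" "x (exp (real (Suc n))) - x (exp (real n))"]
        by simp
      also have "\<dots> \<le> (C + e * q * w n) + e * w n"
        using step by (intro add_mono N) auto
      also have "\<dots> = C + e * (q + 1) * w n"
        by (simp add: algebra_simps)
      also have "\<dots> = C + e * q * (exp H * w n)"
        by (simp only: q(2) mult.assoc)
      also have "\<dots> \<le> C + e * q * w (Suc n)"
        using w_Suc e q by (intro add_left_mono mult_left_mono) auto
      finally show ?case .
    qed
    have bound: "norm (x t) \<le> C + (\<delta> / 2) * (t powr H * g (ln t))" if "exp (real N) \<le> t" for t
    proof -
      have "0 < t" using that exp_gt_zero[of "real N"] by linarith
      then have "real N \<le> ln t" using that by (simp add: ln_ge_iff)
      define n where "n = nat \<lfloor>ln t\<rfloor>"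
      have n: "real n \<le> ln t" "ln t \<le> real (Suc n)" "N \<le> n"
        using \<open>real N \<le> ln t\<close> unfolding n_def by (linarith, linarith, simp add: le_nat_iff le_floor_iff)
      then have t: "exp (real n) \<le> t" "t \<le> exp (real (Suc n))"
        using \<open>0 < t\<close> by (simp_all only: ln_ge_iff[symmetric])
          (metis exp_le_cancel_iff exp_ln)
      have "norm (x t) \<le> norm (x (exp (real n))) + norm (x t - x (exp (real n)))"
        using norm_triangle_ineq[of "x (exp (real n))" "x t - x (exp (real n))"] by simp
      also have "\<dots> \<le> (C + e * q * w n) + e * w n"
        using n t by (intro add_mono N at_exp) auto
      also have "\<dots> = C + e * (q + 1) * w n"
        by (simp add: algebra_simps)
      also have "\<dots> = C + (\<delta> / 2) * w n"
        by (simp only: e(2))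
      also have "w n \<le> t powr H * g (ln t)"
        unfolding w_def using n t \<open>H > 0\<close> g_pos[of "real n"]
        by (intro mult_mono powr_mono2 g_mono) auto
      finally show ?thesis
        using \<open>\<delta> > 0\<close> by (simp add: mult_left_mono)
    qed
    have "((\<lambda>t. C / (t powr H * g (ln t))) \<longlongrightarrow> 0) at_top"
      by (intro real_tendsto_divide_at_top[OF tendsto_const] W_lim)
    then have "\<forall>\<^sub>F t in at_top. C / (t powr H * g (ln t)) < \<delta> / 2"
      using \<open>\<delta> > 0\<close> by (intro order_tendstoD) auto
    moreover have "\<forall>\<^sub>F t in at_top. 0 < t powr H * g (ln t)"
      using W_lim by (simp add: filterlim_at_top_dense)
    moreover have "\<forall>\<^sub>F t in at_top. exp (real N) \<le> t"
      by (rule eventually_ge_at_top)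
    ultimately show "\<forall>\<^sub>F t in at_top. dist (norm (x t) / (t powr H * g (ln t))) 0 < \<delta>"
    proof eventually_elim
      case (elim t)
      define d where "d = t powr H * g (ln t)"
      have "0 < d" "norm (x t) \<le> C + (\<delta> / 2) * d"
        using elim bound by (auto simp: d_def)
      then have "norm (x t) / d \<le> C / d + \<delta> / 2"
        by (simp add: field_simps)
      then have "norm (x t) / (t powr H * g (ln t)) < \<delta>"
        using elim(1) unfolding d_def by linarith
      then show ?case
        using elim(2) by (simp add: dist_real_def)
    qed
  qed
qed


text \<open>A finite upper limit would bound the ratio eventually by some natural number k, in
  particular along t = e^n, where \<open>ln t\<close> is n.\<close>

lemma Limsup_infinity_from_exponential_times:
  fixes x :: "real \<Rightarrow> 'a::real_normed_vector"
  assumes "g \<in> G1"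
    and large: "\<And>k::nat. \<exists>\<^sub>F n in sequentially.
      real k * (exp (real n) powr H * g (real n)) < norm (x (exp (real n)))"
  shows "Limsup at_top (\<lambda>t. ereal (norm (x t) / (t powr H * g (ln t)))) = \<infinity>"
proof (rule ccontr)
  let ?f = "\<lambda>t. norm (x t) / (t powr H * g (ln t))"
  assume "Limsup at_top (\<lambda>t. ereal (?f t)) \<noteq> \<infinity>"
  then obtain k :: nat where "Limsup at_top (\<lambda>t. ereal (?f t)) < ereal (real k)"
    using less_PInf_Ex_of_nat by auto
  then have "\<forall>\<^sub>F t in at_top. ereal (?f t) < ereal (real k)"
    by (rule Limsup_lessD)
  moreover have "filterlim (\<lambda>n. exp (real n)) at_top sequentially"
    by (rule filterlim_compose[OF exp_at_top filterlim_real_sequentially])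
  ultimately have "\<forall>\<^sub>F n in sequentially. ereal (?f (exp (real n))) < ereal (real k)"
    by (rule eventually_compose_filterlim)
  then have "\<forall>\<^sub>F n in sequentially. ?f (exp (real n)) < real k"
    by simp
  from frequently_eventually_frequently[OF large[of k] this]
  obtain n where n: "?f (exp (real n)) < real k"
      "real k * (exp (real n) powr H * g (real n)) < norm (x (exp (real n)))"
    by (auto dest: frequently_ex)
  moreover have "0 < exp (real n) powr H * g (real n)"
    using \<open>g \<in> G1\<close> by (simp add: G1_def)
  ultimately show False
    by (simp add: divide_less_eq)
qed

subsection \<open>Selfsimilar additive processes\<close>

text \<open>The grids are nested in m and contain both end points at every level, so events observed
  on them increase with m.\<close>

definition dyadic_point :: "real \<Rightarrow> real \<Rightarrow> nat \<Rightarrow> nat \<Rightarrow> real" where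
  "dyadic_point u v m k = u + (v - u) * real k / 2 ^ m"

lemma dyadic_point_0 [simp]: "dyadic_point u v m 0 = u"
  and dyadic_point_end [simp]: "dyadic_point u v m (2 ^ m) = v"
  by (simp_all add: dyadic_point_def)

lemma dyadic_point_refine: "dyadic_point u v (Suc m) (2 * k) = dyadic_point u v m k"
  by (simp add: dyadic_point_def)

lemma dyadic_point_mono: "u < v \<Longrightarrow> k < l \<Longrightarrow> dyadic_point u v m k < dyadic_point u v m l"
  by (simp add: dyadic_point_def divide_strict_right_mono)

lemma dyadic_point_ge: "u < v \<Longrightarrow> u \<le> dyadic_point u v m k"
  by (simp add: dyadic_point_def)

text \<open>Every t < v is a limit of grid points from the right, so right-continuity carries the
  bound over; t = v is itself a grid point.\<close>

lemma cadlag_bound_from_dyadic: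
  fixes x :: "real \<Rightarrow> 'a::euclidean_space"
  assumes "cadlag x" and uv: "0 \<le> u" "u < v"
    and bound: "\<And>m k. k \<le> 2 ^ m \<Longrightarrow> norm (x (dyadic_point u v m k) - y) \<le> a"
    and t: "u \<le> t" "t \<le> v"
  shows "norm (x t - y) \<le> a"
proof (cases "t = v")
  case True
  then show ?thesis using bound[of "2 ^ 0" 0] by (simp add: dyadic_point_def)
next
  case False
  then have "t < v" using t by simp
  \<comment> \<open>The successor of the floor gives a grid point strictly to the right of t, as
    \<open>at_right\<close> requires, within one mesh width, and still not beyond v.\<close>
  define k where "k m = Suc (nat \<lfloor>(t - u) / (v - u) * 2 ^ m\<rfloor>)" for m
  define q where "q m = dyadic_point u v m (k m)" for m
  define r where "r = (t - u) / (v - u)"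
  have r: "0 \<le> r" "r < 1" "t = u + (v - u) * r"
    using t \<open>t < v\<close> by (auto simp: r_def)
  have k_bounds: "r * 2 ^ m < real (k m)" "real (k m) \<le> r * 2 ^ m + 1" for m
  proof -
    have "0 \<le> r * 2 ^ m" using r by simp
    then show "r * 2 ^ m < real (k m)" "real (k m) \<le> r * 2 ^ m + 1"
      unfolding k_def r_def[symmetric] by linarith+
  qed
  have "k m \<le> 2 ^ m" for m
  proof -
    have "\<lfloor>r * 2 ^ m\<rfloor> < 2 ^ m"
      using r by (simp add: floor_less_iff)
    then show ?thesis
      unfolding k_def r_def[symmetric] by (simp add: Suc_le_eq nat_less_iff)
  qed
  then have q_bound: "norm (x (q m) - y) \<le> a" for m
    unfolding q_def by (rule bound)
  have q_gt: "t < q m" for m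
    using k_bounds[of m] uv r by (simp add: q_def dyadic_point_def pos_less_divide_eq)
  have q_le: "q m \<le> t + (v - u) * (1 / 2) ^ m" for m
  proof -
    have "(v - u) * real (k m) / 2 ^ m \<le> (v - u) * (r * 2 ^ m + 1) / 2 ^ m"
      using k_bounds[of m] uv by (intro divide_right_mono mult_left_mono) auto
    also have "\<dots> = (v - u) * r + (v - u) * (1 / 2) ^ m"
      by (simp add: field_simps)
    finally show ?thesis using r by (simp add: q_def dyadic_point_def)
  qed
  have "(\<lambda>m. t + (v - u) * (1 / 2) ^ m) \<longlonglongrightarrow> t + (v - u) * 0"
    by (intro tendsto_intros LIMSEQ_realpow_zero) auto
  then have "q \<longlonglongrightarrow> t"
    using q_gt q_le by (intro tendsto_sandwich[of "\<lambda>_. t" q]) (auto intro!: always_eventually less_imp_le)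
  then have "filterlim q (at_right t) sequentially"
    using less_imp_neq[OF q_gt] q_gt by (simp add: filterlim_at eq_commute)
  moreover have "(x \<longlongrightarrow> x t) (at_right t)"
    using \<open>cadlag x\<close> uv t by (auto simp: cadlag_def continuous_within)
  ultimately have "(\<lambda>m. norm (x (q m) - y)) \<longlonglongrightarrow> norm (x t - y)"
    by (intro tendsto_intros) (rule filterlim_compose)
  then show ?thesis
    by (rule LIMSEQ_le_const2) (use q_bound in auto)
qed

section \<open>Scaling relations and a maximal inequality on intervals\<close>

locale selfsimilar_additive_process = prob_space M
  for M :: "'w measure" +
  fixes X :: "real \<Rightarrow> 'w \<Rightarrow> 'a::euclidean_space" and H :: real
  assumes H_pos: "H > 0"
    and selfsimilar_additive: "selfsimilar_additive M H X"
begin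

lemma X_measurable [measurable]: "0 \<le> t \<Longrightarrow> X t \<in> borel_measurable M"
  using selfsimilar_additive by (simp add: selfsimilar_additive_def)

lemma AE_cadlag: "AE \<omega> in M. cadlag (\<lambda>t. X t \<omega>)"
  using selfsimilar_additive by (simp add: selfsimilar_additive_def)

lemma indep_vars_increments:
  fixes s :: "nat \<Rightarrow> real"
  assumes "0 \<le> s 0" "\<And>i. i < n \<Longrightarrow> s i < s (Suc i)"
  shows "indep_vars (\<lambda>_. borel) (\<lambda>i \<omega>. X (s (Suc i)) \<omega> - X (s i) \<omega>) {..<n}"
  using selfsimilar_additive assms unfolding selfsimilar_additive_def indep_increments_def by blast

lemma prob_fdd_scale:
  assumes "c > 0" "finite J" "J \<subseteq> {0..}" and B: "B \<in> sets (PiM J (\<lambda>_. borel))"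
  shows "prob {\<omega>\<in>space M. (\<lambda>u\<in>J. X (c * u) \<omega>) \<in> B} =
    prob {\<omega>\<in>space M. (\<lambda>u\<in>J. (c powr H) *\<^sub>R X u \<omega>) \<in> B}"
proof -
  let ?P = "PiM J (\<lambda>_. borel :: 'a measure)"
  have "distr M ?P (\<lambda>\<omega>. \<lambda>u\<in>J. X (c * u) \<omega>) = distr M ?P (\<lambda>\<omega>. \<lambda>u\<in>J. (c powr H) *\<^sub>R X u \<omega>)"
    using selfsimilar_additive assms
    by (simp add: selfsimilar_additive_def selfsimilar_def same_fdd_def)
  then have "measure (distr M ?P (\<lambda>\<omega>. \<lambda>u\<in>J. X (c * u) \<omega>)) B =
      measure (distr M ?P (\<lambda>\<omega>. \<lambda>u\<in>J. (c powr H) *\<^sub>R X u \<omega>)) B"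
    by simp
  moreover have "0 \<le> u" if "u \<in> J" for u
    using assms that by auto
  then have meas: "(\<lambda>\<omega>. \<lambda>u\<in>J. X (c * u) \<omega>) \<in> measurable M ?P"
      "(\<lambda>\<omega>. \<lambda>u\<in>J. (c powr H) *\<^sub>R X u \<omega>) \<in> measurable M ?P"
    using \<open>c > 0\<close>
    by (intro measurable_restrict borel_measurable_scaleR borel_measurable_const X_measurable; simp)+
  moreover have "{\<omega>\<in>space M. f \<omega> \<in> B} = f -` B \<inter> space M" for f
    by auto
  ultimately show ?thesis
    by (simp only: measure_distr[OF _ B])
qed

lemma prob_increment_scale:
  assumes "c > 0" "0 \<le> s" "0 \<le> t"
  shows "prob {\<omega>\<in>space M. c powr H * a < norm (X (c * t) \<omega> - X (c * s) \<omega>)} =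
    prob {\<omega>\<in>space M. a < norm (X t \<omega> - X s \<omega>)}"
proof -
  define B where "B = {f\<in>space (PiM {s, t} (\<lambda>_. borel :: 'a measure)). c powr H * a < norm (f t - f s)}"
  have "B \<in> sets (PiM {s, t} (\<lambda>_. borel))"
    unfolding B_def
    by (intro borel_measurable_less borel_measurable_norm borel_measurable_diff
        measurable_component_singleton borel_measurable_const) auto
  then have "prob {\<omega>\<in>space M. (\<lambda>u\<in>{s, t}. X (c * u) \<omega>) \<in> B} =
      prob {\<omega>\<in>space M. (\<lambda>u\<in>{s, t}. (c powr H) *\<^sub>R X u \<omega>) \<in> B}"
    using assms by (intro prob_fdd_scale) auto
  then show ?thesis
    using \<open>c > 0\<close> by (simp add: B_def space_PiM flip: scaleR_diff_right)
qed

text \<open>Taken from the one-dimensional marginal, so that the value \<open>X 0\<close> does not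
  enter as it would through an increment from time 0.\<close>

lemma prob_X_scale:
  assumes "c > 0"
  shows "prob {\<omega>\<in>space M. c powr H * a < norm (X c \<omega>)} = prob {\<omega>\<in>space M. a < norm (X 1 \<omega>)}"
proof -
  define B where "B = {f\<in>space (PiM {1::real} (\<lambda>_. borel :: 'a measure)). c powr H * a < norm (f 1)}"
  have "B \<in> sets (PiM {1} (\<lambda>_. borel))"
    unfolding B_def
    by (intro borel_measurable_less borel_measurable_norm
        measurable_component_singleton borel_measurable_const) auto
  then have "prob {\<omega>\<in>space M. (\<lambda>u\<in>{1}. X (c * u) \<omega>) \<in> B} =
      prob {\<omega>\<in>space M. (\<lambda>u\<in>{1}. (c powr H) *\<^sub>R X u \<omega>) \<in> B}"
    using assms by (intro prob_fdd_scale) auto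
  then show ?thesis
    using \<open>c > 0\<close> by (simp add: B_def space_PiM)
qed

text \<open>Ottaviani's inequality on each grid gives a bound independent of the level m; the nested
  grids allow passage to the union by continuity from below.\<close>

lemma maximal_inequality_dyadic:
  assumes uv: "0 \<le> u" "u < v"
    and tail: "\<And>t. u \<le> t \<Longrightarrow> t \<le> v \<Longrightarrow> prob {\<omega>\<in>space M. b < norm (X v \<omega> - X t \<omega>)} \<le> 1 / 2"
  shows "prob {\<omega>\<in>space M. \<exists>m. \<exists>k\<le>2 ^ m. a + b < norm (X (dyadic_point u v m k) \<omega> - X u \<omega>)} \<le>
    2 * prob {\<omega>\<in>space M. a < norm (X v \<omega> - X u \<omega>)}"
proof -
  let ?p = "dyadic_point u v"
  define E where "E m = {\<omega>\<in>space M. \<exists>k\<le>2 ^ m. a + b < norm (X (?p m k) \<omega> - X u \<omega>)}" for m :: nat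
  have [measurable]: "X (?p m k) \<in> borel_measurable M" for m k
    using dyadic_point_ge[of u v m k] uv by (intro X_measurable) auto
  have [measurable]: "X u \<in> borel_measurable M"
    using uv by simp
  have E_sets: "E m \<in> events" for m
    unfolding E_def by measurable
  have telescope: "(\<Sum>i=k..<l. X (?p m (Suc i)) \<omega> - X (?p m i) \<omega>) = X (?p m l) \<omega> - X (?p m k) \<omega>"
    if "k \<le> l" for m k l \<omega>
    using sum_Suc_diff'[of k l "\<lambda>i. X (?p m i) \<omega>"] that by simp
  have E_prob: "prob (E m) \<le> 2 * prob {\<omega>\<in>space M. a < norm (X v \<omega> - X u \<omega>)}" for m
  proof -
    let ?D = "\<lambda>i \<omega>. X (?p m (Suc i)) \<omega> - X (?p m i) \<omega>"
    have "prob {\<omega>\<in>space M. \<exists>k\<le>2 ^ m. a + b < norm (\<Sum>i<k. ?D i \<omega>)} \<le>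
        2 * prob {\<omega>\<in>space M. a < norm (\<Sum>i<2 ^ m. ?D i \<omega>)}"
    proof (rule ottaviani)
      show "indep_vars (\<lambda>_. borel) ?D {..<2 ^ m}"
        using uv by (intro indep_vars_increments dyadic_point_mono) auto
      fix k :: nat assume "k \<le> 2 ^ m"
      moreover have "?p m k \<le> v"
        using dyadic_point_mono[OF uv(2), of k "2 ^ m" m] \<open>k \<le> 2 ^ m\<close> by (cases "k = 2 ^ m") auto
      ultimately show "prob {\<omega>\<in>space M. b < norm (\<Sum>i=k..<2 ^ m. ?D i \<omega>)} \<le> 1 / 2"
        using tail[of "?p m k"] dyadic_point_ge[OF uv(2)] by (simp add: telescope)
    qed
    then show ?thesis
      by (simp add: E_def lessThan_atLeast0 telescope)
  qed
  have "incseq E"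
  proof (rule incseq_SucI)
    fix m show "E m \<subseteq> E (Suc m)"
    proof
      fix \<omega> assume "\<omega> \<in> E m"
      then obtain k where "\<omega> \<in> space M" "k \<le> 2 ^ m" "a + b < norm (X (?p m k) \<omega> - X u \<omega>)"
        by (auto simp: E_def)
      then show "\<omega> \<in> E (Suc m)"
        unfolding E_def by (auto intro!: exI[of _ "2 * k"] simp: dyadic_point_refine)
    qed
  qed
  then have "(\<lambda>m. prob (E m)) \<longlonglongrightarrow> prob (\<Union>m. E m)"
    using E_sets by (intro finite_Lim_measure_incseq) auto
  then have "prob (\<Union>m. E m) \<le> 2 * prob {\<omega>\<in>space M. a < norm (X v \<omega> - X u \<omega>)}"
    using E_prob by (intro LIMSEQ_le_const2) auto
  also have "(\<Union>m. E m) = {\<omega>\<in>space M. \<exists>m. \<exists>k\<le>2 ^ m. a + b < norm (X (?p m k) \<omega> - X u \<omega>)}"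
    by (auto simp: E_def)
  finally show ?thesis .
qed

end

section \<open>Logarithmic moment and the two halves of the integral test\<close>

context selfsimilar_additive_process
begin

text \<open>A random variable whose law is \<open>\<rho>\<^sub>1\<close>.\<close>

definition unit_increment :: "'w \<Rightarrow> 'a" where
  "unit_increment \<omega> = X 1 \<omega> - X (exp (- 1)) \<omega>"

lemma unit_increment_measurable [measurable]: "unit_increment \<in> borel_measurable M"
  unfolding unit_increment_def by measurable

text \<open>Scaling by e^r carries the times e^-1 and 1 to e^(r-1) and e^r. Negative r serve the
  behaviour near time 0, positive r the growth at infinity.\<close>

lemma prob_exponential_increment:
  "prob {\<omega>\<in>space M. exp r powr H * a < norm (X (exp r) \<omega> - X (exp (r - 1)) \<omega>)} =
    prob {\<omega>\<in>space M. a < norm (unit_increment \<omega>)}"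
  using prob_increment_scale[of "exp r" "exp (- 1)" 1 a]
  by (simp add: unit_increment_def exp_diff exp_minus field_simps)

text \<open>The increments along \<open>e\<^sup>-\<^sup>n\<close> tend to \<open>0\<close> because paths are right-continuous at \<open>0\<close>; as they are
  independent, their tail probabilities at level \<open>1\<close> must be summable.\<close>

lemma log_moment_unit_increment:
  "(\<integral>\<^sup>+\<omega>. ennreal (max 0 (ln (norm (unit_increment \<omega>)))) \<partial>M) < \<infinity>"
proof -
  define D where "D i \<omega> = X (exp (- real i)) \<omega> - X (exp (- real i - 1)) \<omega>" for i \<omega>
  have "indep_vars (\<lambda>_. borel) D {..<n}" for n
  proof -
    \<comment> \<open>Independence of increments is stated for increasing times, whereas
      \<open>D\<close> runs backwards from time 1 to 0; the index i corresponds to n - 1 -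
      i.\<close>
    define s where "s i = exp (real i - real n)" for i
    define V where "V i \<omega> = X (s (Suc i)) \<omega> - X (s i) \<omega>" for i \<omega>
    have "indep_vars (\<lambda>_. borel) V {..<n}"
      unfolding V_def by (rule indep_vars_increments) (auto simp: s_def)
    moreover have image: "(\<lambda>i. n - Suc i) ` {..<n} = {..<n}"
    proof (intro set_eqI iffI)
      fix i assume "i \<in> {..<n}"
      then show "i \<in> (\<lambda>i. n - Suc i) ` {..<n}"
        by (intro image_eqI[where x = "n - Suc i"]) auto
    qed auto
    moreover have "inj_on (\<lambda>i. n - Suc i) {..<n}"
      by (auto simp: inj_on_def)
    ultimately have "indep_vars (\<lambda>_. borel) (\<lambda>i. V (n - Suc i)) {..<n}"
      using indep_vars_reindex[of "\<lambda>i. n - Suc i" "{..<n}" "\<lambda>_. borel" V]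
      by (simp only: image simp_thms)
    moreover have "V (n - Suc i) = D i" if "i < n" for i
    proof -
      have "s (Suc (n - Suc i)) = exp (- real i)" "s (n - Suc i) = exp (- real i - 1)"
        using that by (simp_all add: s_def of_nat_diff)
      then show ?thesis by (simp add: V_def D_def fun_eq_iff)
    qed
    ultimately show ?thesis
      using indep_vars_cong[OF refl _ refl, of "{..<n}" "\<lambda>i. V (n - Suc i)" D "\<lambda>_. borel"]
      by (simp only: lessThan_iff)
  qed
  then have indep: "indep_vars (\<lambda>_. borel) D UNIV"
    by (rule indep_vars_UNIV_I)
  \<comment> \<open>With the scaling factor e^(-Hi), level 1 for \<open>D i\<close> becomes level
    e^(Hi) for the unit increment.\<close>
  have D_prob: "prob {\<omega>\<in>space M. D i \<omega> \<in> {x. 1 < norm x}} =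
      prob {\<omega>\<in>space M. exp (H * real i) < norm (unit_increment \<omega>)}" for i
    using prob_exponential_increment[of "- real i" "exp (H * real i)"]
    by (simp add: D_def powr_def flip: exp_add)
  have "summable (\<lambda>i. prob {\<omega>\<in>space M. D i \<omega> \<in> {x. 1 < norm x}})"
  proof (rule ccontr)
    assume "\<not> ?thesis"
    then have "AE \<omega> in M. \<exists>\<^sub>F i in sequentially. D i \<omega> \<in> {x. 1 < norm x}"
      by (intro borel_cantelli_AE2[OF indep]) auto
    moreover have "AE \<omega> in M. \<forall>\<^sub>F i in sequentially. norm (D i \<omega>) < 1"
      using AE_cadlag
    proof eventually_elim
      case (elim \<omega>)
      have lim: "((\<lambda>t. X t \<omega>) \<longlongrightarrow> X 0 \<omega>) (at_right 0)"
        using elim by (auto simp: cadlag_def continuous_within)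
      have "(\<lambda>i. exp (- real i - c)) \<longlonglongrightarrow> 0" for c
        by real_asymp
      then have "filterlim (\<lambda>i. exp (- real i - c)) (at_right 0) sequentially" for c
        by (simp add: filterlim_at)
      from filterlim_compose[OF lim this] have "(\<lambda>i. X (exp (- real i - c)) \<omega>) \<longlonglongrightarrow> X 0 \<omega>" for c .
      from tendsto_diff[OF this[of 0] this[of 1]] have "(\<lambda>i. D i \<omega>) \<longlonglongrightarrow> 0"
        by (simp add: D_def)
      then show ?case
        using order_tendstoD(2)[OF tendsto_norm_zero, of "\<lambda>i. D i \<omega>" sequentially 1] by simp
    qed
    ultimately have "AE \<omega> in M. False"
     proof eventually_elim
      case (elim \<omega>)
      from frequently_eventually_frequently[OF elim] show False
        by (auto dest: frequently_ex)
    qed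
    then show False by simp
  qed
  then have summ: "summable (\<lambda>i. prob {\<omega>\<in>space M. exp (H * real i) < norm (unit_increment \<omega>)})"
    by (simp only: D_prob)
  define W where "W \<omega> = max 0 (ln (norm (unit_increment \<omega>))) / H" for \<omega>
  have [measurable]: "W \<in> borel_measurable M"
    unfolding W_def by measurable
  have "exp (H * real n) < norm (unit_increment \<omega>)" if "real (Suc n) \<le> W \<omega>" for n \<omega>
  proof -
    have "H * real (Suc n) \<le> max 0 (ln (norm (unit_increment \<omega>)))"
      using that H_pos by (simp add: W_def field_simps)
    moreover have "0 < H * real (Suc n)"
      using H_pos by simp
    ultimately have le: "H * real (Suc n) \<le> ln (norm (unit_increment \<omega>))" and
      "ln (norm (unit_increment \<omega>)) \<noteq> 0" by linarith+
    \<comment> \<open>Since \<open>ln 0\<close> is 0, a nonzero logarithm excludes norm 0.\<close>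
    then have "0 < norm (unit_increment \<omega>)" by auto
    with le have "exp (H * real (Suc n)) \<le> norm (unit_increment \<omega>)"
      by (simp only: ln_ge_iff)
    moreover have "exp (H * real n) < exp (H * real (Suc n))"
      using H_pos by simp
    ultimately show ?thesis by linarith
  qed
  then have "prob {\<omega>\<in>space M. real (Suc n) \<le> W \<omega>} \<le>
      prob {\<omega>\<in>space M. exp (H * real n) < norm (unit_increment \<omega>)}" for n
    by (intro finite_measure_mono) auto
  then have "summable (\<lambda>n. prob {\<omega>\<in>space M. real (Suc n) \<le> W \<omega>})"
    by (intro summable_comparison_test'[OF summ]) auto
  then have "(\<integral>\<^sup>+\<omega>. ennreal (W \<omega>) \<partial>M) < \<infinity>"
    using H_pos by (subst nn_integral_finite_iff_summable_tail) (auto simp: W_def)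
  then have "ennreal H * (\<integral>\<^sup>+\<omega>. ennreal (W \<omega>) \<partial>M) < \<infinity>"
    by (simp add: ennreal_mult_less_top)
  also have "ennreal H * (\<integral>\<^sup>+\<omega>. ennreal (W \<omega>) \<partial>M) =
      (\<integral>\<^sup>+\<omega>. ennreal (max 0 (ln (norm (unit_increment \<omega>)))) \<partial>M)"
    using H_pos by (subst nn_integral_cmult[symmetric]) (auto simp: W_def simp del: ennreal_max_0 simp flip: ennreal_mult)
  finally show ?thesis .
qed

text \<open>On each block the maximal inequality bounds the probability of a large oscillation by
  twice a tail of the unit increment. Borel-Cantelli then gives the block bounds for each fixed e,
  and countably many e suffice.\<close>

lemma AE_limit_zero:
  assumes g: "g \<in> G1"
    and summ: "\<And>c. c > 0 \<Longrightarrow> summable (\<lambda>n. prob {\<omega>\<in>space M. g (real n) < c * norm (unit_increment \<omega>)})"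
  shows "AE \<omega> in M. ((\<lambda>t. norm (X t \<omega>) / (t powr H * g (ln t))) \<longlongrightarrow> 0) at_top"
proof -
  define w where "w n = exp (real n) powr H * g (real n)" for n
  have w_pos: "0 < w n" for n
    using g by (simp add: w_def G1_def)
  have "LIM n sequentially. g (real n) :> at_top"
    using g filterlim_real_sequentially by (auto simp: G1_def intro: filterlim_compose)
  have "(\<lambda>k. prob {\<omega>\<in>space M. real k < norm (X 1 \<omega>)}) \<longlonglongrightarrow> prob (\<Inter>k. {\<omega>\<in>space M. real k < norm (X 1 \<omega>)})"
    by (intro finite_Lim_measure_decseq) (auto simp: decseq_def)
  also have "(\<Inter>k. {\<omega>\<in>space M. real k < norm (X 1 \<omega>)}) = {}"
    using reals_Archimedean2 by (auto dest: less_asym)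
  finally have "(\<lambda>k. prob {\<omega>\<in>space M. real k < norm (X 1 \<omega>)}) \<longlonglongrightarrow> 0"
    by simp
  from order_tendstoD(2)[OF this, of "1 / 4"] obtain K :: nat
    where K: "prob {\<omega>\<in>space M. real K < norm (X 1 \<omega>)} < 1 / 4"
    unfolding eventually_sequentially by auto
  \<comment> \<open>Selfsimilarity turns the single bound K for \<open>X 1\<close> into one that is
    uniform over all times in (0, v].\<close>
  have X_tail: "prob {\<omega>\<in>space M. y < norm (X t \<omega>)} \<le> 1 / 4"
    if "0 < t" "t \<le> v" "v powr H * real K \<le> y" for t v y
  proof -
    have "t powr H * real K \<le> y"
      using that H_pos by (intro order_trans[OF mult_right_mono that(3)] powr_mono2) auto
    then have "prob {\<omega>\<in>space M. y < norm (X t \<omega>)} \<le> prob {\<omega>\<in>space M. t powr H * real K < norm (X t \<omega>)}"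
      using \<open>0 < t\<close> by (intro finite_measure_mono) auto
    then show ?thesis
      using K prob_X_scale[OF \<open>0 < t\<close>] by simp
  qed
  have blocks: "AE \<omega> in M. \<forall>\<^sub>F n in sequentially. \<forall>t\<in>{exp (real n)..exp (real (Suc n))}.
      norm (X t \<omega> - X (exp (real n)) \<omega>) \<le> e * w n" if "e > 0" for e
  proof -
    define E where "E n = {\<omega>\<in>space M. \<exists>m. \<exists>k\<le>2 ^ m. e * w n <
      norm (X (dyadic_point (exp (real n)) (exp (real (Suc n))) m k) \<omega> - X (exp (real n)) \<omega>)}" for n
    have [measurable]: "X (dyadic_point (exp (real n)) (exp (real (Suc n))) m k) \<in> borel_measurable M"
        "X (exp (real n)) \<in> borel_measurable M" for n m k
      using dyadic_point_ge[of "exp (real n)" "exp (real (Suc n))" m k] exp_ge_zero[of "real n"]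
      by (auto intro!: X_measurable simp del: exp_ge_zero)
    have E_sets: "E n \<in> events" for n
      unfolding E_def by measurable
    \<comment> \<open>Makes \<open>e * w n / 2\<close> the level \<open>g n / c\<close> rescaled to
      time e^(n+1); the factor \<open>exp H\<close> accounts for w being normalised at the left end
      of the block.\<close>
    define c where "c = 2 * exp H / e"
    have "c > 0" using \<open>e > 0\<close> by (simp add: c_def)
    have half: "exp (real (Suc n)) powr H * (g (real n) / c) = e * w n / 2" for n
    proof -
      have "exp (real (Suc n)) powr H = exp H * exp (real n) powr H"
        by (simp add: exp_powr_real algebra_simps flip: exp_add)
      then show ?thesis using \<open>e > 0\<close> by (simp add: c_def w_def)
    qed
    have "\<forall>\<^sub>F n in sequentially. 2 * real K * c \<le> g (real n)"
      using \<open>LIM n sequentially. g (real n) :> at_top\<close> by (simp add: filterlim_at_top)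
    then have "\<forall>\<^sub>F n in sequentially. norm (prob (E n)) \<le>
        2 * prob {\<omega>\<in>space M. g (real n) < c * norm (unit_increment \<omega>)}"
    proof eventually_elim
      case (elim n)
      let ?u = "exp (real n)" and ?v = "exp (real (Suc n))"
      \<comment> \<open>This puts the level \<open>e * w n / 4\<close> in the range of
        \<open>X_tail\<close>. Two such tails, at v and at t, add up to the 1/2 required by the
        maximal inequality with a and b both equal to \<open>e * w n / 2\<close>.\<close>
      have quarter: "?v powr H * real K \<le> e * w n / 4"
      proof -
        have "?v powr H * real K \<le> ?v powr H * (g (real n) / c / 2)"
          using elim \<open>c > 0\<close> by (intro mult_left_mono) (auto simp: field_simps)
        also have "\<dots> = e * w n / 4"
          using half[of n] by (simp add: mult_ac)
        finally show ?thesis .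
      qed
      have "prob (E n) \<le> 2 * prob {\<omega>\<in>space M. e * w n / 2 < norm (X ?v \<omega> - X ?u \<omega>)}"
      proof -
        have "prob {\<omega>\<in>space M. e * w n / 2 < norm (X ?v \<omega> - X t \<omega>)} \<le> 1 / 2"
          if "?u \<le> t" "t \<le> ?v" for t
        proof -
          have "0 < t" using that exp_gt_zero[of "real n"] by linarith
          then have [measurable]: "X t \<in> borel_measurable M" "X ?v \<in> borel_measurable M"
            by simp_all
          have "prob {\<omega>\<in>space M. e * w n / 2 < norm (X ?v \<omega> - X t \<omega>)} \<le>
              prob ({\<omega>\<in>space M. e * w n / 4 < norm (X ?v \<omega>)} \<union> {\<omega>\<in>space M. e * w n / 4 < norm (X t \<omega>)})"
          proof (rule finite_measure_mono)
            have "e * w n / 4 < norm y \<or> e * w n / 4 < norm z" if "e * w n / 2 < norm (y - z)"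
              for y z :: 'a
              using that norm_triangle_ineq4[of y z] by linarith
            then show "{\<omega>\<in>space M. e * w n / 2 < norm (X ?v \<omega> - X t \<omega>)} \<subseteq>
                {\<omega>\<in>space M. e * w n / 4 < norm (X ?v \<omega>)} \<union> {\<omega>\<in>space M. e * w n / 4 < norm (X t \<omega>)}"
              by auto
          qed measurable
          also have "\<dots> \<le> prob {\<omega>\<in>space M. e * w n / 4 < norm (X ?v \<omega>)} +
              prob {\<omega>\<in>space M. e * w n / 4 < norm (X t \<omega>)}"
            by (intro measure_Un_le) measurable
          also have "\<dots> \<le> 1 / 4 + 1 / 4"
            using that \<open>0 < t\<close> quarter by (intro add_mono X_tail[of _ ?v]) auto
          finally show ?thesis by simp
        qed
        then show ?thesis
          using maximal_inequality_dyadic[of ?u ?v "e * w n / 2" "e * w n / 2"] by (simp add: E_def)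
      qed
      also have "prob {\<omega>\<in>space M. e * w n / 2 < norm (X ?v \<omega> - X ?u \<omega>)} =
          prob {\<omega>\<in>space M. g (real n) / c < norm (unit_increment \<omega>)}"
        using prob_exponential_increment[of "real (Suc n)" "g (real n) / c", unfolded half] by simp
      also have "\<dots> = prob {\<omega>\<in>space M. g (real n) < c * norm (unit_increment \<omega>)}"
        using \<open>c > 0\<close> by (simp add: divide_less_eq mult.commute)
      finally show ?case by simp
    qed
    then have "summable (\<lambda>n. prob (E n))"
      using summ[OF \<open>c > 0\<close>] by (rule summable_comparison_test_ev[OF _ summable_mult])
    then have "AE \<omega> in M. \<forall>\<^sub>F n in sequentially. \<omega> \<in> space M - E n"
      using E_sets by (intro borel_cantelli_AE1) (auto simp: emeasure_eq_measure)
    with AE_cadlag show ?thesis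
    proof eventually_elim
      case (elim \<omega>)
      from elim(2) show ?case
      proof eventually_elim
        case (elim n)
        then have "norm (X (dyadic_point (exp (real n)) (exp (real (Suc n))) m k) \<omega> -
            X (exp (real n)) \<omega>) \<le> e * w n" if "k \<le> 2 ^ m" for m k
          using that by (auto simp: E_def not_less)
        then show ?case
          using cadlag_bound_from_dyadic[OF \<open>cadlag (\<lambda>t. X t \<omega>)\<close>,
              of "exp (real n)" "exp (real (Suc n))"] by simp
      qed
    qed
  qed
  have "AE \<omega> in M. \<forall>j. \<forall>\<^sub>F n in sequentially. \<forall>t\<in>{exp (real n)..exp (real (Suc n))}.
      norm (X t \<omega> - X (exp (real n)) \<omega>) \<le> inverse (real (Suc j)) * w n"
    by (intro AE_all_countable[THEN iffD2] allI blocks) simp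
  then show ?thesis
  proof eventually_elim
    case (elim \<omega>)
    show ?case
    proof (rule growth_from_exponential_blocks[OF H_pos g])
      fix e :: real assume "e > 0"
      then obtain j where "inverse (real (Suc j)) < e"
        using reals_Archimedean by blast
      then have "inverse (real (Suc j)) * w n \<le> e * w n" for n
        using w_pos[of n] by (intro mult_right_mono) auto
      then show "\<forall>\<^sub>F n in sequentially. \<forall>t\<in>{exp (real n)..exp (real (Suc n))}.
          norm (X t \<omega> - X (exp (real n)) \<omega>) \<le> e * (exp (real n) powr H * g (real n))"
        using elim[rule_format, of j] unfolding w_def[symmetric]
        by (auto elim!: eventually_mono intro: order_trans)
    qed
  qed
qed

text \<open>By the second Borel-Cantelli lemma infinitely many increments are huge, and one end
  point of each must carry at least half of its norm.\<close>

lemma AE_Limsup_infinity: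
  assumes g: "g \<in> G1"
    and div: "\<And>c. c > 0 \<Longrightarrow> \<not> summable (\<lambda>n. prob {\<omega>\<in>space M. g (real n) < c * norm (unit_increment \<omega>)})"
  shows "AE \<omega> in M. Limsup at_top (\<lambda>t. ereal (norm (X t \<omega>) / (t powr H * g (ln t)))) = \<infinity>"
proof -
  define w where "w n = exp (real n) powr H * g (real n)" for n
  have w_pos: "0 < w n" for n
    using g by (simp add: w_def G1_def)
  have w_mono: "w n \<le> w (Suc n)" for n
    unfolding w_def using g H_pos
    by (intro mult_mono powr_mono2) (auto simp: G1_def mono_on_def less_imp_le)
  define Y where "Y n \<omega> = X (exp (real (Suc n))) \<omega> - X (exp (real n)) \<omega>" for n \<omega>
  have "indep_vars (\<lambda>_. borel) Y {..<n}" for n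
    unfolding Y_def by (rule indep_vars_increments) auto
  then have indep: "indep_vars (\<lambda>_. borel) Y UNIV"
    by (rule indep_vars_UNIV_I)
  have "AE \<omega> in M. \<exists>\<^sub>F n in sequentially. Y n \<omega> \<in> {y. 2 * real (Suc k) * w (Suc n) < norm y}" for k :: nat
  proof (rule borel_cantelli_AE2[OF indep])
    \<comment> \<open>The 2 allows for splitting the norm between two end points;
      \<open>Suc k\<close> keeps the denominator positive for k = 0.\<close>
    define c where "c = 1 / (2 * real (Suc k))"
    have "c > 0" by (simp add: c_def)
    have "prob {\<omega>\<in>space M. Y n \<omega> \<in> {y. 2 * real (Suc k) * w (Suc n) < norm y}} =
        prob {\<omega>\<in>space M. g (real (Suc n)) < c * norm (unit_increment \<omega>)}" for n
    proof -
      have "exp (real (Suc n)) powr H * (g (real (Suc n)) / c) = 2 * real (Suc k) * w (Suc n)"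
        by (simp add: c_def w_def)
      from prob_exponential_increment[of "real (Suc n)" "g (real (Suc n)) / c", unfolded this]
      have "prob {\<omega>\<in>space M. Y n \<omega> \<in> {y. 2 * real (Suc k) * w (Suc n) < norm y}} =
          prob {\<omega>\<in>space M. g (real (Suc n)) / c < norm (unit_increment \<omega>)}"
        by (simp add: Y_def)
      also have "\<dots> = prob {\<omega>\<in>space M. g (real (Suc n)) < c * norm (unit_increment \<omega>)}"
        using \<open>c > 0\<close> by (simp only: divide_less_eq mult.commute if_True)
      finally show ?thesis .
    qed
    then show "\<not> summable (\<lambda>n. prob {\<omega>\<in>space M. Y n \<omega> \<in> {y. 2 * real (Suc k) * w (Suc n) < norm y}})"
      using div[OF \<open>c > 0\<close>]
        summable_Suc_iff[of "\<lambda>n. prob {\<omega>\<in>space M. g (real n) < c * norm (unit_increment \<omega>)}"] by simp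
  qed auto
  then have "AE \<omega> in M. \<forall>k. \<exists>\<^sub>F n in sequentially. 2 * real (Suc k) * w (Suc n) < norm (Y n \<omega>)"
    by (simp add: AE_all_countable)
  then show ?thesis
  proof eventually_elim
    case (elim \<omega>)
    show ?case
    proof (rule Limsup_infinity_from_exponential_times[OF g])
      fix k :: nat
      have "\<exists>n\<ge>N. real k * w n < norm (X (exp (real n)) \<omega>)" for N
      proof -
        obtain n where n: "n \<ge> N" "2 * real (Suc k) * w (Suc n) < norm (Y n \<omega>)"
          using elim[rule_format, of k] unfolding frequently_sequentially by blast
        \<comment> \<open>Monotonicity of w lets the level at the right end of the block also serve
          the left end.\<close>
        have le: "real k * w n \<le> real (Suc k) * w (Suc n)" "real k * w (Suc n) \<le> real (Suc k) * w (Suc n)"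
          using w_mono[of n] w_pos[of n] w_pos[of "Suc n"] by (auto intro!: mult_mono)
        have "norm (Y n \<omega>) \<le> norm (X (exp (real (Suc n))) \<omega>) + norm (X (exp (real n)) \<omega>)"
          unfolding Y_def by (rule norm_triangle_ineq4)
        then have "real k * w (Suc n) < norm (X (exp (real (Suc n))) \<omega>) \<or>
            real k * w n < norm (X (exp (real n)) \<omega>)"
          using n(2) le by linarith
        then show ?thesis
          using n(1) le_SucI by blast
      qed
      then show "\<exists>\<^sub>F n in sequentially. real k * (exp (real n) powr H * g (real n)) < norm (X (exp (real n)) \<omega>)"
        unfolding frequently_sequentially w_def by blast
    qed
  qed
qed

end

theorem theorem2p19:
  fixes M :: "'w measure"
    and X :: "real \<Rightarrow> 'w \<Rightarrow> 'a::euclidean_space"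
    and H :: real
    and g :: "real \<Rightarrow> real"
    and \<rho>\<^sub>1 :: "'a measure"
  assumes "prob_space M"
    and "H > 0"
    and "selfsimilar_additive M H X"
    and "nondeterministic M H X"
    and "\<rho>\<^sub>1 = distr M borel (\<lambda>\<omega>. X 1 \<omega> - X (exp (-1)) \<omega>)"
    and "g \<in> G1"
    and "(\<lambda>x. gen_inverse g x + ln x) \<in> OR_class"
  shows "((\<integral>\<^sup>+ x. ennreal (gen_inverse g (norm x)) \<partial>\<rho>\<^sub>1) < \<infinity> \<longrightarrow>
      (AE \<omega> in M. Limsup at_top (\<lambda>t. ereal (norm (X t \<omega>) / (t powr H * g (ln t)))) = 0)) \<and>
     ((\<integral>\<^sup>+ x. ennreal (gen_inverse g (norm x)) \<partial>\<rho>\<^sub>1) = \<infinity> \<longrightarrow>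
      (AE \<omega> in M. Limsup at_top (\<lambda>t. ereal (norm (X t \<omega>) / (t powr H * g (ln t)))) = \<infinity>))"
proof -
  interpret prob_space M by fact
  interpret selfsimilar_additive_process M X H
    by unfold_locales fact+
  note [measurable] = measurable_gen_inverse[OF \<open>g \<in> G1\<close>]
  have \<rho>: "(\<integral>\<^sup>+ x. ennreal (gen_inverse g (norm x)) \<partial>\<rho>\<^sub>1) =
      (\<integral>\<^sup>+ \<omega>. ennreal (gen_inverse g (norm (unit_increment \<omega>))) \<partial>M)"
    using \<open>\<rho>\<^sub>1 = _\<close> by (simp add: nn_integral_distr flip: unit_increment_def)
  \<comment> \<open>The left side does not depend on c, so one integral decides the series for all c
    at once, in both directions.\<close>
  have finite_iff: "(\<integral>\<^sup>+ \<omega>. ennreal (gen_inverse g (norm (unit_increment \<omega>))) \<partial>M) < \<infinity> \<longleftrightarrow>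
      summable (\<lambda>n. prob {\<omega>\<in>space M. g (real n) < c * norm (unit_increment \<omega>)})" if "c > 0" for c
    using that assms log_moment_unit_increment
    by (intro nn_integral_gen_inverse_iff_summable) auto
  show ?thesis
  proof (intro conjI impI)
    assume "(\<integral>\<^sup>+ x. ennreal (gen_inverse g (norm x)) \<partial>\<rho>\<^sub>1) < \<infinity>"
    then have "AE \<omega> in M. ((\<lambda>t. norm (X t \<omega>) / (t powr H * g (ln t))) \<longlongrightarrow> 0) at_top"
      using finite_iff \<rho> by (intro AE_limit_zero \<open>g \<in> G1\<close>) simp
    then show "AE \<omega> in M. Limsup at_top (\<lambda>t. ereal (norm (X t \<omega>) / (t powr H * g (ln t)))) = 0"
      by eventually_elim (intro lim_imp_Limsup; simp add: zero_ereal_def)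
  next
    assume "(\<integral>\<^sup>+ x. ennreal (gen_inverse g (norm x)) \<partial>\<rho>\<^sub>1) = \<infinity>"
    then have "\<not> summable (\<lambda>n. prob {\<omega>\<in>space M. g (real n) < c * norm (unit_increment \<omega>)})"
      if "c > 0" for c
      unfolding finite_iff[OF that, symmetric] \<rho> by simp
    then show "AE \<omega> in M. Limsup at_top (\<lambda>t. ereal (norm (X t \<omega>) / (t powr H * g (ln t)))) = \<infinity>"
      by (rule AE_Limsup_infinity[OF \<open>g \<in> G1\<close>])
  qed
qed

end
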